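(* Let $n\ge 3$, let $A_1,\dots,A_n$ be qubit systems, let $A_1',\dots,A_n'$ be finite-dimensional quantum systems, with party $m$ holding $A_mA_m'$ for $m=1,\dots,n$. Then any $n$-party secret-sharing state $\rho_n$ on $A_1\cdots A_nA_1'\cdots A_n'$ is bipartite distillable for every bipartite split of the $n$ parties, i.e. for every partition of the set of parties into two nonempty groups.
   Context: A string $I\in\{0,1\}^n$ has even parity if it contains an even number of ones. A density operator on $A_1\cdots A_nA_1'\cdots A_n'$ ($A_1,\dots,A_n$ qubits) is an *$n$-party secret-sharing state* if it is of the form $$\frac{1}{2^{n-1}}\sum_{\substack{I,J\in\{0,1\}^n\\ I,J\ \text{of even parity}}}|I\rangle\langle J|_{A_1\cdots A_n}\otimes U_I\,\rho_{A_1'\cdots A_n'}\,U_J^{\dagger}$$ for some density operator $\rho_{A_1'\cdots A_n'}$ on $A_1'\cdots A_n'$ and some unitary operators $U_I$ on $A_1'\cdots A_n'$ (one for each $I\in\{0,1\}^n$ of even parity). For a split of the parties into two groups, regard $\rho_n$ as a bipartite state in which each group acts as a single laboratory (arbitrary joint operations are allowed within a group). A bipartite state is *(bipartite) distillable* if, from sufficiently many copies of it, local operations and classical communication (LOCC) between the two laboratories can produce, with nonzero probability, a two-qubit state with fidelity arbitrarily close to 1 with the maximally entangled state $\frac{1}{\sqrt2}(|00\rangle+|11\rangle)$. *)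

theory Defs
  imports "HOL-Analysis.Analysis"
begin

(* Finite-dimensional operators are matrices indexed by finite sets of basis labels. The index
   sets are passed explicitly, and entries outside them are irrelevant. *)

type_synonym ('x, 'y) cmat = "'x \<Rightarrow> 'y \<Rightarrow> complex"

definition mmult :: "'z set \<Rightarrow> ('x, 'z) cmat \<Rightarrow> ('z, 'y) cmat \<Rightarrow> ('x, 'y) cmat" where
  "mmult Z A B = (\<lambda>x y. \<Sum>z\<in>Z. A x z * B z y)"

definition madj :: "('x, 'y) cmat \<Rightarrow> ('y, 'x) cmat" where
  "madj A = (\<lambda>y x. cnj (A x y))"

definition mtensor :: "('x, 'y) cmat \<Rightarrow> ('u, 'v) cmat \<Rightarrow> ('x \<times> 'u, 'y \<times> 'v) cmat" where
  "mtensor A B = (\<lambda>(x, u) (y, v). A x y * B u v)"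

definition mtrace :: "'x set \<Rightarrow> ('x, 'x) cmat \<Rightarrow> complex" where
  "mtrace X A = (\<Sum>x\<in>X. A x x)"

(* the operator A \<sigma> B^*, with \<sigma> acting on the space with basis X *)
definition sandwich :: "'x set \<Rightarrow> ('y, 'x) cmat \<Rightarrow> ('x, 'x) cmat \<Rightarrow> ('z, 'x) cmat \<Rightarrow> ('y, 'z) cmat" where
  "sandwich X A \<sigma> B = mmult X (mmult X A \<sigma>) (madj B)"

definition density_operator :: "'x set \<Rightarrow> ('x, 'x) cmat \<Rightarrow> bool" where
  "density_operator X \<sigma> \<longleftrightarrow>
     (\<forall>x\<in>X. \<forall>y\<in>X. \<sigma> x y = cnj (\<sigma> y x)) \<and>
     (\<forall>v. 0 \<le> Re (\<Sum>x\<in>X. \<Sum>y\<in>X. cnj (v x) * \<sigma> x y * v y)) \<and>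
     mtrace X \<sigma> = 1"

definition unitary_operator :: "'x set \<Rightarrow> ('x, 'x) cmat \<Rightarrow> bool" where
  "unitary_operator X U \<longleftrightarrow>
     (\<forall>x\<in>X. \<forall>y\<in>X. mmult X (madj U) U x y = of_bool (x = y) \<and>
                  mmult X U (madj U) x y = of_bool (x = y))"


(* The parties are 1, ..., n. A basis label of the whole system assigns to party m the pair of its
   bit (system A_m) and its label below d m (system A'_m, of dimension d m). *)

definition bit_strings :: "nat \<Rightarrow> (nat \<Rightarrow> nat) set" where
  "bit_strings n = (\<Pi>\<^sub>E m\<in>{1..n}. {0, 1})"

definition even_strings :: "nat \<Rightarrow> (nat \<Rightarrow> nat) set" where
  "even_strings n = {I \<in> bit_strings n. even (card {m \<in> {1..n}. I m = 1})}"

definition shield_basis :: "nat \<Rightarrow> (nat \<Rightarrow> nat) \<Rightarrow> (nat \<Rightarrow> nat) set" where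
  "shield_basis n d = (\<Pi>\<^sub>E m\<in>{1..n}. {..<d m})"

definition group_basis :: "nat set \<Rightarrow> (nat \<Rightarrow> nat) \<Rightarrow> (nat \<Rightarrow> nat \<times> nat) set" where
  "group_basis S d = (\<Pi>\<^sub>E m\<in>S. {0, 1} \<times> {..<d m})"

definition key_part :: "nat \<Rightarrow> (nat \<Rightarrow> nat \<times> nat) \<Rightarrow> (nat \<Rightarrow> nat)" where
  "key_part n x = (\<lambda>m\<in>{1..n}. fst (x m))"

definition shield_part :: "nat \<Rightarrow> (nat \<Rightarrow> nat \<times> nat) \<Rightarrow> (nat \<Rightarrow> nat)" where
  "shield_part n x = (\<lambda>m\<in>{1..n}. snd (x m))"

definition ketbra :: "'x \<Rightarrow> 'x \<Rightarrow> ('x, 'x) cmat" where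
  "ketbra I J = (\<lambda>x y. of_bool (x = I) * of_bool (y = J))"

definition secret_sharing_state ::
  "nat \<Rightarrow> (nat \<Rightarrow> nat) \<Rightarrow> (nat \<Rightarrow> nat \<times> nat, nat \<Rightarrow> nat \<times> nat) cmat \<Rightarrow> bool" where
  "secret_sharing_state n d \<sigma> \<longleftrightarrow>
     density_operator (group_basis {1..n} d) \<sigma> \<and>
     (\<exists>\<rho> U. density_operator (shield_basis n d) \<rho> \<and>
        (\<forall>I\<in>even_strings n. unitary_operator (shield_basis n d) (U I)) \<and>
        (\<forall>x\<in>group_basis {1..n} d. \<forall>y\<in>group_basis {1..n} d.
           \<sigma> x y = 1 / 2 ^ (n - 1) *
             (\<Sum>I\<in>even_strings n. \<Sum>J\<in>even_strings n.
                mtensor (ketbra I J) (sandwich (shield_basis n d) (U I) \<rho> (U J))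
                  (key_part n x, shield_part n x) (key_part n y, shield_part n y))))"

(* the n-party operator regarded as an operator on (group S) \<otimes> (remaining parties) *)
definition bipartition ::
  "nat \<Rightarrow> nat set \<Rightarrow> (nat \<Rightarrow> 'x, nat \<Rightarrow> 'x) cmat \<Rightarrow>
     ((nat \<Rightarrow> 'x) \<times> (nat \<Rightarrow> 'x), (nat \<Rightarrow> 'x) \<times> (nat \<Rightarrow> 'x)) cmat" where
  "bipartition n S \<sigma> = (\<lambda>u v. \<sigma> (merge S ({1..n} - S) u) (merge S ({1..n} - S) v))"


(* A Kraus operator (d, K) maps the space with a given basis to the d-dimensional space
   with basis 0, ..., d - 1. *)

type_synonym 'x kraus = "nat \<times> (nat, 'x) cmat"

definition kraus_comp :: "nat kraus \<Rightarrow> 'x kraus \<Rightarrow> 'x kraus" where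
  "kraus_comp M K = (fst M, mmult {..<fst K} (snd M) (snd K))"

(* the completeness relation: the sum of all K^* K is the identity *)
definition measurement :: "'x set \<Rightarrow> 'x kraus list \<Rightarrow> bool" where
  "measurement X Ms \<longleftrightarrow>
     (\<forall>x\<in>X. \<forall>y\<in>X. (\<Sum>(d, K)\<leftarrow>Ms. mmult {..<d} (madj K) K x y) = of_bool (x = y))"

(* Finite-round LOCC protocols between laboratories with bases X and Y, listed by their
   branches. Every branch stands for one history of measurement outcomes, known to both sides,
   and carries the local Kraus operators accumulated along it. In each round one laboratory
   performs a measurement that may depend on the history, splitting that branch. A one-outcome
   measurement is an isometry; in the rule start these fix coordinates of both laboratories. *)
inductive locc :: "'a set \<Rightarrow> 'b set \<Rightarrow> ('a kraus \<times> 'b kraus) list \<Rightarrow> bool"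
  for X :: "'a set" and Y :: "'b set" where
  start: "measurement X [V] \<Longrightarrow> measurement Y [W] \<Longrightarrow> locc X Y [(V, W)]"
| left: "locc X Y (bs @ (K, L) # cs) \<Longrightarrow> measurement {..<fst K} Ms \<Longrightarrow>
     locc X Y (bs @ map (\<lambda>M. (kraus_comp M K, L)) Ms @ cs)"
| right: "locc X Y (bs @ (K, L) # cs) \<Longrightarrow> measurement {..<fst L} Ms \<Longrightarrow>
     locc X Y (bs @ map (\<lambda>M. (K, kraus_comp M L)) Ms @ cs)"

(* unnormalised: the trace is the probability of the branch *)
definition branch_output ::
  "'a set \<Rightarrow> 'b set \<Rightarrow> ('a \<times> 'b, 'a \<times> 'b) cmat \<Rightarrow> 'a kraus \<times> 'b kraus \<Rightarrow>
     (nat \<times> nat, nat \<times> nat) cmat" where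
  "branch_output X Y \<sigma> b =
     sandwich (X \<times> Y) (mtensor (snd (fst b)) (snd (snd b))) \<sigma>
       (mtensor (snd (fst b)) (snd (snd b)))"

definition two_qubits :: "(nat \<times> nat) set" where
  "two_qubits = {0, 1} \<times> {0, 1}"

definition max_entangled :: "nat \<times> nat \<Rightarrow> complex" where
  "max_entangled = (\<lambda>(i, j). of_bool (i = j) / sqrt 2)"

definition fidelity_max_entangled :: "(nat \<times> nat, nat \<times> nat) cmat \<Rightarrow> real" where
  "fidelity_max_entangled \<omega> =
     Re (\<Sum>u\<in>two_qubits. \<Sum>v\<in>two_qubits. cnj (max_entangled u) * \<omega> u v * max_entangled v)"

definition copies ::
  "nat \<Rightarrow> ('a \<times> 'b, 'a \<times> 'b) cmat \<Rightarrow> ((nat \<Rightarrow> 'a) \<times> (nat \<Rightarrow> 'b), (nat \<Rightarrow> 'a) \<times> (nat \<Rightarrow> 'b)) cmat" where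
  "copies k \<sigma> = (\<lambda>(a, b) (a', b'). \<Prod>t<k. \<sigma> (a t, b t) (a' t, b' t))"

(* good is the set of branches on which success is declared; \<omega> is the unnormalised output of
   the successful runs and p their total probability *)
definition distillable :: "'a set \<Rightarrow> 'b set \<Rightarrow> ('a \<times> 'b, 'a \<times> 'b) cmat \<Rightarrow> bool" where
  "distillable X Y \<sigma> \<longleftrightarrow>
     (\<forall>\<epsilon>>0. \<exists>k bs good.
        locc ({..<k} \<rightarrow>\<^sub>E X) ({..<k} \<rightarrow>\<^sub>E Y) bs \<and>
        good \<subseteq> {..<length bs} \<and>
        (\<forall>j\<in>good. fst (fst (bs ! j)) = 2 \<and> fst (snd (bs ! j)) = 2) \<and>
        (let \<omega> = (\<lambda>u v. \<Sum>j\<in>good.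
                     branch_output ({..<k} \<rightarrow>\<^sub>E X) ({..<k} \<rightarrow>\<^sub>E Y) (copies k \<sigma>) (bs ! j) u v);
             p = Re (mtrace two_qubits \<omega>)
         in 0 < p \<and> fidelity_max_entangled (\<lambda>u v. \<omega> u v / complex_of_real p) \<ge> 1 - \<epsilon>))"

end

theory Submission
  imports Defs
begin

text \<open>
  Flipping one bit on each side of the split gives two even strings which differ in the parity on
  both sides. Together with shield labels at which the block \<open>U\<^sub>I \<rho> U\<^sub>J\<^sup>\<dagger>\<close> does not vanish they yield
  local basis vectors \<open>x\<^sub>0, x\<^sub>1\<close> and \<open>y\<^sub>0, y\<^sub>1\<close> such that the state, compressed to their span, lives on
  \<open>x\<^sub>0y\<^sub>0\<close> and \<open>x\<^sub>1y\<^sub>1\<close> only, with diagonal entries \<open>p\<^sub>0, p\<^sub>1\<close> and coherence \<open>c \<noteq> 0\<close>. On two copies, the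
  span of \<open>x\<^sub>0x\<^sub>1\<close> and \<open>x\<^sub>1x\<^sub>0\<close> (and likewise for \<open>y\<close>) carries equal diagonal entries \<open>A = p\<^sub>0p\<^sub>1\<close> and the
  positive coherence \<open>B = \<bar>c\<bar>\<^sup>2\<close>, a maximally entangled state with phase noise only. On \<open>k\<close> such
  pairs both laboratories apply the filter \<open>\<bar>0\<rangle>\<langle>+\<bar>\<^sup>k + \<bar>1\<rangle>\<langle>-\<bar>\<^sup>k\<close>; the outcome has fidelity
  \<open>1 / (1 + r\<^sup>k)\<close> with \<open>r = (A - B) / (A + B)\<close>, which tends to 1.
\<close>

section \<open>Encoding pairs of copies and filtering them\<close>

text \<open>Each pair of copies carries one logical bit: positions \<open>2 * t\<close> and
  \<open>2 * t + 1\<close> hold \<open>x (s t)\<close> and \<open>x (\<not> s t)\<close>.\<close>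

definition codeword :: "nat \<Rightarrow> (bool \<Rightarrow> 'x) \<Rightarrow> (nat \<Rightarrow> bool) \<Rightarrow> nat \<Rightarrow> 'x" where
  "codeword k x s = (\<lambda>t\<in>{..<2 * k}. x (s (t div 2) = even t))"

text \<open>The rows 0 and 1 are those of the Hadamard matrix without its factor, that is,
  unnormalised plus and minus vectors.\<close>

definition flip_sign :: "nat \<Rightarrow> bool \<Rightarrow> complex" where
  "flip_sign i a = (if i = 1 \<and> a then - 1 else 1)"

text \<open>The Kraus operator \<open>\<bar>0\<rangle>\<langle>+\<bar>\<^sup>k + \<bar>1\<rangle>\<langle>-\<bar>\<^sup>k\<close>, where \<open>s\<close> runs over the bit strings of the \<open>k\<close> pairs.\<close>
definition parity_filter :: "nat \<Rightarrow> (bool \<Rightarrow> 'x) \<Rightarrow> (nat, nat \<Rightarrow> 'x) cmat" where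
  "parity_filter k x = (\<lambda>i w. (\<Sum>s\<in>{..<k} \<rightarrow>\<^sub>E UNIV.
     of_bool (w = codeword k x s) * (\<Prod>t<k. flip_sign i (s t))) / complex_of_real (sqrt (2 ^ k)))"

lemma prod_lessThan_double:
  fixes f :: "nat \<Rightarrow> 'a :: comm_monoid_mult"
  shows "(\<Prod>t<2 * k. f t) = (\<Prod>t<k. f (2 * t) * f (2 * t + 1))"
  by (induction k) (simp_all add: ac_simps)

lemma sum_PiE_prod:
  fixes f :: "nat \<Rightarrow> 'a \<Rightarrow> 'b :: comm_semiring_1"
  assumes "finite A"
  shows "(\<Sum>s\<in>{..<k} \<rightarrow>\<^sub>E A. \<Prod>t<k. f t (s t)) = (\<Prod>t<k. \<Sum>a\<in>A. f t a)"
  using prod_sum_PiE[of "{..<k}" "\<lambda>_. A" f] assms by simp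

lemma codeword_inj:
  assumes "x True \<noteq> x False"
  shows "inj_on (codeword k x) ({..<k} \<rightarrow>\<^sub>E UNIV)"
proof (rule inj_onI)
  fix s r assume s: "s \<in> {..<k} \<rightarrow>\<^sub>E UNIV" and r: "r \<in> {..<k} \<rightarrow>\<^sub>E UNIV"
    and eq: "codeword k x s = codeword k x r"
  show "s = r"
  proof (rule PiE_ext[OF s r])
    fix t assume "t \<in> {..<k}"
    then have "x (s t) = x (r t)"
      using fun_cong[OF eq, of "2 * t"] by (simp add: codeword_def)
    then show "s t = r t" using assms by (metis (full_types))
  qed
qed

lemma codeword_in: "range x \<subseteq> X \<Longrightarrow> codeword k x s \<in> {..<2 * k} \<rightarrow>\<^sub>E X"
  by (auto simp: codeword_def)

text \<open>The filter is supported on codewords, so a sum against it collapses to one over logical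
  bit strings. Every application of a filter below is evaluated in this way.\<close>

lemma sum_parity_filter:
  assumes "finite X" "range x \<subseteq> X"
  shows "(\<Sum>w\<in>{..<2 * k} \<rightarrow>\<^sub>E X. parity_filter k x i w * F w) =
    (\<Sum>s\<in>{..<k} \<rightarrow>\<^sub>E UNIV. (\<Prod>t<k. flip_sign i (s t)) * F (codeword k x s)) / complex_of_real (sqrt (2 ^ k))"
proof -
  have fin: "finite ({..<2 * k} \<rightarrow>\<^sub>E X)" using assms by (intro finite_PiE) auto
  have "(\<Sum>w\<in>{..<2 * k} \<rightarrow>\<^sub>E X. parity_filter k x i w * F w) =
    (\<Sum>s\<in>{..<k} \<rightarrow>\<^sub>E UNIV. \<Sum>w\<in>{..<2 * k} \<rightarrow>\<^sub>E X.
      of_bool (w = codeword k x s) * ((\<Prod>t<k. flip_sign i (s t)) * F w)) / complex_of_real (sqrt (2 ^ k))"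
    unfolding parity_filter_def
    by (subst sum.swap) (simp add: sum_divide_distrib sum_distrib_right mult.assoc)
  also have "\<dots> = (\<Sum>s\<in>{..<k} \<rightarrow>\<^sub>E UNIV. (\<Prod>t<k. flip_sign i (s t)) * F (codeword k x s)) / complex_of_real (sqrt (2 ^ k))"
    using codeword_in[OF assms(2)] fin
    by (auto intro!: arg_cong2[where f="(/)"] sum.cong simp: of_bool_def if_distrib[of "\<lambda>z. z * _"] cong: if_cong)
  finally show ?thesis .
qed

lemma cnj_flip_sign [simp]: "cnj (flip_sign i a) = flip_sign i a"
  by (simp add: flip_sign_def)

lemma cnj_parity_filter [simp]: "cnj (parity_filter k x i w) = parity_filter k x i w"
  by (simp add: parity_filter_def of_bool_def if_distrib[of cnj] cong: if_cong)

lemma parity_filter_codeword: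
  assumes "x True \<noteq> x False" "s \<in> {..<k} \<rightarrow>\<^sub>E UNIV"
  shows "parity_filter k x i (codeword k x s) = (\<Prod>t<k. flip_sign i (s t)) / complex_of_real (sqrt (2 ^ k))"
proof -
  have "(\<Sum>r\<in>{..<k} \<rightarrow>\<^sub>E UNIV. of_bool (codeword k x s = codeword k x r) * (\<Prod>t<k. flip_sign i (r t))) =
    (\<Sum>r\<in>{..<k} \<rightarrow>\<^sub>E UNIV. of_bool (s = r) * (\<Prod>t<k. flip_sign i (r t)))"
    using codeword_inj[OF assms(1)] assms(2) by (intro sum.cong) (auto dest: inj_onD)
  also have "\<dots> = (\<Prod>t<k. flip_sign i (s t))"
    using assms(2) finite_PiE[of "{..<k}" "\<lambda>_. UNIV :: bool set"]
    by (simp add: of_bool_def if_distrib[of "\<lambda>z. z * _"] cong: if_cong)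
  finally show ?thesis by (simp add: parity_filter_def)
qed

lemma of_real_sqrt_two_power_mult_self: "complex_of_real (sqrt (2 ^ k)) * complex_of_real (sqrt (2 ^ k)) = 2 ^ k"
  by (simp flip: of_real_mult)

text \<open>The inner product of two rows factors over the pairs into the \<open>k\<close>-th power
  of an inner product of Hadamard rows, which is 2 or 0.\<close>

lemma parity_filter_orthonormal:
  assumes "finite X" "range x \<subseteq> X" "x True \<noteq> x False" "k > 0" "i < 2" "j < 2"
  shows "mmult ({..<2 * k} \<rightarrow>\<^sub>E X) (parity_filter k x) (madj (parity_filter k x)) i j = of_bool (i = j)"
proof -
  let ?r = "complex_of_real (sqrt (2 ^ k))"
  have "mmult ({..<2 * k} \<rightarrow>\<^sub>E X) (parity_filter k x) (madj (parity_filter k x)) i j =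
    (\<Sum>w\<in>{..<2 * k} \<rightarrow>\<^sub>E X. parity_filter k x i w * parity_filter k x j w)"
    by (simp add: mmult_def madj_def)
  also have "\<dots> = (\<Sum>s\<in>{..<k} \<rightarrow>\<^sub>E UNIV. (\<Prod>t<k. flip_sign i (s t)) * ((\<Prod>t<k. flip_sign j (s t)) / ?r)) / ?r"
    unfolding sum_parity_filter[OF assms(1,2)] using assms(3)
    by (intro arg_cong2[where f="(/)"] sum.cong) (simp_all add: parity_filter_codeword)
  also have "\<dots> = (\<Sum>s\<in>{..<k} \<rightarrow>\<^sub>E UNIV. \<Prod>t<k. flip_sign i (s t) * flip_sign j (s t)) / 2 ^ k"
    by (simp add: prod.distrib of_real_sqrt_two_power_mult_self flip: sum_divide_distrib)
  also have "\<dots> = (\<Sum>a\<in>UNIV. flip_sign i a * flip_sign j a) ^ k / 2 ^ k"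
    by (subst sum_PiE_prod) simp_all
  \<comment> \<open>For \<open>i \<noteq> j\<close> this is the power \<open>0 ^ k\<close>, which
    vanishes because \<open>k > 0\<close>.\<close>
  also have "\<dots> = of_bool (i = j)"
    using assms(4-6) by (auto simp: UNIV_bool flip_sign_def less_2_cases_iff)
  finally show ?thesis .
qed

section \<open>Local filters as LOCC protocols\<close>

text \<open>What a laboratory needs in order to apply \<open>K\<close>: an isometry onto numeric
  labels, as a protocol must begin with one, and a two-outcome measurement whose first outcome is
  \<open>K\<close> read in these coordinates.\<close>

lemma measurement_of_orthonormal_rows:
  assumes "finite X" "\<And>i j. i < d \<Longrightarrow> j < d \<Longrightarrow> mmult X K (madj K) i j = of_bool (i = j)"
    and "bij_betw e X {..<N}"
  shows "measurement X [(N, \<lambda>m x. of_bool (m = e x))]"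
    and "\<exists>K' M. measurement {..<N} [(d, K'), M] \<and>
       (\<forall>i. \<forall>x\<in>X. mmult {..<N} K' (\<lambda>m x. of_bool (m = e x)) i x = K i x)"
proof -
  have e: "inj_on e X" "e ` X = {..<N}" using assms(3) by (auto simp: bij_betw_def)
  show "measurement X [(N, \<lambda>m x. of_bool (m = e x))]"
  proof -
    have "(\<Sum>z<N. cnj (of_bool (z = e x)) * of_bool (z = e y)) = (of_bool (x = y) :: complex)"
      if "x \<in> X" "y \<in> X" for x y
    proof -
      have "e x < N" using e that by auto
      have "(\<Sum>z<N. cnj (of_bool (z = e x)) * of_bool (z = e y)) = (\<Sum>z<N. if z = e x then of_bool (e x = e y) else 0 :: complex)"
        by (intro sum.cong) auto
      also have "\<dots> = of_bool (x = y)" using \<open>e x < N\<close> e that by (auto dest: inj_onD)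
      finally show ?thesis .
    qed
    then show ?thesis by (simp add: measurement_def mmult_def madj_def)
  qed
  define g where "g = the_inv_into X e"
  have ge: "g (e x) = x" if "x \<in> X" for x using that e by (simp add: g_def the_inv_into_f_f)
  define K' where "K' = (\<lambda>i m. K i (g m))"
  define P where "P = mmult {..<d} (madj K') K'"
  \<comment> \<open>\<open>P = K\<^sup>* K\<close> is a projection, so its complement \<open>Q\<close> serves as the second Kraus operator\<close>
  define Q where "Q = (\<lambda>m m'. of_bool (m = m') - P m m')"
  have orth: "(\<Sum>m<N. K' i m * cnj (K' j m)) = of_bool (i = j)" if "i < d" "j < d" for i j
  proof -
    have "(\<Sum>m<N. K' i m * cnj (K' j m)) = (\<Sum>x\<in>X. K' i (e x) * cnj (K' j (e x)))"
      using sum.reindex[OF e(1), of "\<lambda>m. K' i m * cnj (K' j m)"] e(2) by simp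
    also have "\<dots> = of_bool (i = j)"
      using assms(2)[OF that] by (simp add: mmult_def madj_def K'_def ge cong: sum.cong)
    finally show ?thesis .
  qed
  have Pherm: "cnj (P m m') = P m' m" for m m'
    by (simp add: P_def mmult_def madj_def mult.commute)
  \<comment> \<open>The square of \<open>P\<close> contains the product of \<open>K'\<close> with
    its adjoint in the middle, which is the identity by \<open>orth\<close>.\<close>
  have PP: "(\<Sum>l<N. P m l * P l m') = P m m'" for m m'
  proof -
    have "(\<Sum>l<N. P m l * P l m') =
      (\<Sum>l<N. \<Sum>i<d. \<Sum>j<d. cnj (K' i m) * K' j m' * (K' i l * cnj (K' j l)))"
      by (simp add: P_def mmult_def madj_def sum_product mult_ac)
    also have "\<dots> = (\<Sum>i<d. \<Sum>j<d. cnj (K' i m) * K' j m' * (\<Sum>l<N. K' i l * cnj (K' j l)))"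
      by (subst sum.swap, rule sum.cong[OF refl], subst sum.swap) (simp add: sum_distrib_left)
    also have "\<dots> = (\<Sum>i<d. \<Sum>j<d. if i = j then cnj (K' i m) * K' j m' else 0)"
      by (intro sum.cong refl) (simp add: orth)
    also have "\<dots> = P m m'" by (simp add: P_def mmult_def madj_def)
    finally show ?thesis .
  qed
  have QQ: "mmult {..<N} (madj Q) Q m m' = Q m m'" if "m < N" "m' < N" for m m'
  proof -
    have "mmult {..<N} (madj Q) Q m m' = (\<Sum>l<N. (of_bool (m = l) - P m l) * (of_bool (l = m') - P l m'))"
      unfolding mmult_def madj_def Q_def by (intro sum.cong) (auto simp: Pherm)
    also have "\<dots> = (\<Sum>l<N. (if l = m then of_bool (m = m') - P m m' else 0) - (if l = m' then P m m' else 0) + P m l * P l m')"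
      by (intro sum.cong) (auto simp: algebra_simps)
    also have "\<dots> = Q m m'" using that by (simp add: sum.distrib sum_subtractf PP Q_def)
    finally show ?thesis .
  qed
  \<comment> \<open>By \<open>QQ\<close> the completeness sum is \<open>P + Q\<close>, which is the
    identity by the definition of \<open>Q\<close>.\<close>
  have "measurement {..<N} [(d, K'), (N, Q)]"
    by (simp add: measurement_def QQ flip: P_def) (simp add: Q_def)
  moreover have "mmult {..<N} K' (\<lambda>m x. of_bool (m = e x)) i x = K i x" if "x \<in> X" for i x
  proof -
    have "e x < N" using e that by auto
    have "mmult {..<N} K' (\<lambda>m x. of_bool (m = e x)) i x = (\<Sum>m<N. if m = e x then K' i m else 0)"
      unfolding mmult_def by (intro sum.cong) auto
    also have "\<dots> = K i x" using \<open>e x < N\<close> that by (simp add: K'_def ge)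
    finally show ?thesis .
  qed
  ultimately show "\<exists>K' M. measurement {..<N} [(d, K'), M] \<and>
       (\<forall>i. \<forall>x\<in>X. mmult {..<N} K' (\<lambda>m x. of_bool (m = e x)) i x = K i x)" by blast
qed

text \<open>The left laboratory measures first; the right one measures only in the branch where the
  left filter succeeded. The branch of two successes heads the list.\<close>

lemma locc_local_filters:
  assumes "finite X" "finite Y"
    and "\<And>i j. i < d \<Longrightarrow> j < d \<Longrightarrow> mmult X K (madj K) i j = of_bool (i = j)"
    and "\<And>i j. i < d' \<Longrightarrow> j < d' \<Longrightarrow> mmult Y L (madj L) i j = of_bool (i = j)"
  obtains K' L' bs where "locc X Y (((d, K'), (d', L')) # bs)"
    "\<And>i x. x \<in> X \<Longrightarrow> K' i x = K i x" "\<And>j y. y \<in> Y \<Longrightarrow> L' j y = L j y"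
proof -
  obtain e where e: "bij_betw e X {..<card X}"
    using assms(1) ex_bij_betw_finite_nat[of X] by (auto simp: atLeast0LessThan)
  obtain f where f: "bij_betw f Y {..<card Y}"
    using assms(2) ex_bij_betw_finite_nat[of Y] by (auto simp: atLeast0LessThan)
  let ?V = "\<lambda>m x. of_bool (m = e x) :: complex" and ?W = "\<lambda>m y. of_bool (m = f y) :: complex"
  note mK = measurement_of_orthonormal_rows[OF assms(1,3) e]
  note mL = measurement_of_orthonormal_rows[OF assms(2,4) f]
  obtain K' M where K': "measurement {..<card X} [(d, K'), M]"
    "\<And>i x. x \<in> X \<Longrightarrow> mmult {..<card X} K' ?V i x = K i x" using mK(2) by blast
  obtain L' R where L': "measurement {..<card Y} [(d', L'), R]"
    "\<And>i x. x \<in> Y \<Longrightarrow> mmult {..<card Y} L' ?W i x = L i x" using mL(2) by blast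
  have "locc X Y [((card X, ?V), (card Y, ?W))]" by (rule locc.start[OF mK(1) mL(1)])
  then have "locc X Y [(kraus_comp (d, K') (card X, ?V), (card Y, ?W)), (kraus_comp M (card X, ?V), (card Y, ?W))]"
    using locc.left[of X Y "[]" "(card X, ?V)" "(card Y, ?W)" "[]" "[(d, K'), M]"] K'(1) by simp
  then have "locc X Y ((kraus_comp (d, K') (card X, ?V), kraus_comp (d', L') (card Y, ?W)) #
     [(kraus_comp (d, K') (card X, ?V), kraus_comp R (card Y, ?W)), (kraus_comp M (card X, ?V), (card Y, ?W))])"
    using locc.right[of X Y "[]" "kraus_comp (d, K') (card X, ?V)" "(card Y, ?W)"
      "[(kraus_comp M (card X, ?V), (card Y, ?W))]" "[(d', L'), R]"] L'(1) by simp
  then show ?thesis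
    by (intro that[of "mmult {..<card X} K' ?V" "mmult {..<card Y} L' ?W"])
       (auto simp: kraus_comp_def K'(2) L'(2))
qed

section \<open>Output of the filters on many copies\<close>

text \<open>The four sums are meant for the row and column indices of both laboratories. They are
  pulled into the product one at a time, the innermost first.\<close>

lemma sum_PiE_prod4:
  fixes F :: "'a \<Rightarrow> 'a \<Rightarrow> 'a \<Rightarrow> 'a \<Rightarrow> 'b :: comm_semiring_1" and k :: nat
  assumes "finite A"
  defines "P \<equiv> {..<k::nat} \<rightarrow>\<^sub>E A"
  shows "(\<Sum>s\<in>P. \<Sum>r\<in>P. \<Sum>s'\<in>P. \<Sum>r'\<in>P. \<Prod>t<k. F (s t) (r t) (s' t) (r' t)) =
    (\<Sum>a\<in>A. \<Sum>b\<in>A. \<Sum>a'\<in>A. \<Sum>b'\<in>A. F a b a' b') ^ k"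
proof -
  note sp = sum_PiE_prod[OF assms(1)]
  have 1: "(\<Sum>r'\<in>P. \<Prod>t<k. F (s t) (r t) (s' t) (r' t)) = (\<Prod>t<k. \<Sum>b'\<in>A. F (s t) (r t) (s' t) b')" for s r s'
    unfolding P_def by (rule sp[where f = "\<lambda>t. F (s t) (r t) (s' t)"])
  have 2: "(\<Sum>s'\<in>P. \<Prod>t<k. \<Sum>b'\<in>A. F (s t) (r t) (s' t) b') = (\<Prod>t<k. \<Sum>a'\<in>A. \<Sum>b'\<in>A. F (s t) (r t) a' b')" for s r
    unfolding P_def by (rule sp[where f = "\<lambda>t a'. \<Sum>b'\<in>A. F (s t) (r t) a' b'"])
  have 3: "(\<Sum>r\<in>P. \<Prod>t<k. \<Sum>a'\<in>A. \<Sum>b'\<in>A. F (s t) (r t) a' b') = (\<Prod>t<k. \<Sum>b\<in>A. \<Sum>a'\<in>A. \<Sum>b'\<in>A. F (s t) b a' b')" for s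
    unfolding P_def by (rule sp[where f = "\<lambda>t b. \<Sum>a'\<in>A. \<Sum>b'\<in>A. F (s t) b a' b'"])
  have 4: "(\<Sum>s\<in>P. \<Prod>t<k. \<Sum>b\<in>A. \<Sum>a'\<in>A. \<Sum>b'\<in>A. F (s t) b a' b') = (\<Prod>t<k. \<Sum>a\<in>A. \<Sum>b\<in>A. \<Sum>a'\<in>A. \<Sum>b'\<in>A. F a b a' b')"
    unfolding P_def by (rule sp[where f = "\<lambda>t a. \<Sum>b\<in>A. \<Sum>a'\<in>A. \<Sum>b'\<in>A. F a b a' b'"])
  show ?thesis by (simp add: 1 2 3 4)
qed

text \<open>The nesting puts each sum into the form of the left side of
  \<open>sum_parity_filter\<close>, which can then be applied four times.\<close>

lemma branch_output_eq_iterated_sums: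
  assumes "\<And>i w. w \<in> X \<Longrightarrow> K i w = A i w" "\<And>j v. v \<in> Y \<Longrightarrow> L j v = B j v"
  shows "branch_output X Y \<tau> ((m, K), (m', L)) (i, j) (i', j') =
    (\<Sum>w\<in>X. cnj (A i' w) * (\<Sum>v\<in>Y. cnj (B j' v) * (\<Sum>w'\<in>X. A i w' * (\<Sum>v'\<in>Y. B j v' * \<tau> (w', v') (w, v)))))"
proof -
  have "branch_output X Y \<tau> ((m, K), (m', L)) (i, j) (i', j') =
    (\<Sum>w\<in>X. \<Sum>v\<in>Y. (\<Sum>w'\<in>X. \<Sum>v'\<in>Y. K i w' * L j v' * \<tau> (w', v') (w, v)) * cnj (K i' w * L j' v))"
    by (simp add: branch_output_def sandwich_def mmult_def madj_def mtensor_def sum.cartesian_product')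
  also have "\<dots> = (\<Sum>w\<in>X. \<Sum>v\<in>Y. (\<Sum>w'\<in>X. \<Sum>v'\<in>Y. A i w' * B j v' * \<tau> (w', v') (w, v)) * cnj (A i' w * B j' v))"
    by (simp add: assms cong: sum.cong)
  also have "\<dots> = (\<Sum>w\<in>X. cnj (A i' w) * (\<Sum>v\<in>Y. cnj (B j' v) * (\<Sum>w'\<in>X. A i w' * (\<Sum>v'\<in>Y. B j v' * \<tau> (w', v') (w, v)))))"
    by (simp add: sum_distrib_left sum_distrib_right mult_ac)
  finally show ?thesis .
qed

lemma copies_codeword:
  "copies (2 * k) \<sigma> (codeword k x s, codeword k y r) (codeword k x s', codeword k y r') =
    (\<Prod>t<k. \<sigma> (x (s t), y (r t)) (x (s' t), y (r' t)) * \<sigma> (x (\<not> s t), y (\<not> r t)) (x (\<not> s' t), y (\<not> r' t)))"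
  unfolding copies_def prod.case prod_lessThan_double
  by (intro prod.cong) (auto simp: codeword_def)

text \<open>Filter signs and copies both factor over the pairs, so the output is the
  \<open>k\<close>-th power of the result for one pair. The four normalisations
  \<open>sqrt (2 ^ k)\<close> multiply to \<open>4 ^ k\<close>.\<close>

lemma filtered_copies:
  assumes "finite X" "finite Y" "range x \<subseteq> X" "range y \<subseteq> Y"
    and "\<And>i w. w \<in> {..<2 * k} \<rightarrow>\<^sub>E X \<Longrightarrow> K i w = parity_filter k x i w"
    and "\<And>j v. v \<in> {..<2 * k} \<rightarrow>\<^sub>E Y \<Longrightarrow> L j v = parity_filter k y j v"
  shows "branch_output ({..<2 * k} \<rightarrow>\<^sub>E X) ({..<2 * k} \<rightarrow>\<^sub>E Y) (copies (2 * k) \<sigma>) ((m, K), (m', L)) (i, j) (i', j') =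
    ((\<Sum>a'\<in>UNIV. \<Sum>b'\<in>UNIV. \<Sum>a\<in>UNIV. \<Sum>b\<in>UNIV.
       flip_sign i' a' * flip_sign j' b' * flip_sign i a * flip_sign j b *
       (\<sigma> (x a, y b) (x a', y b') * \<sigma> (x (\<not> a), y (\<not> b)) (x (\<not> a'), y (\<not> b')))) / 4) ^ k"
proof -
  let ?r = "complex_of_real (sqrt (2 ^ k))"
  let ?P = "{..<k} \<rightarrow>\<^sub>E (UNIV :: bool set)"
  have r4: "?r * (?r * (?r * ?r)) = 4 ^ k"
    unfolding mult.assoc[symmetric] of_real_sqrt_two_power_mult_self unfolding mult.assoc of_real_sqrt_two_power_mult_self
    by (simp flip: power_mult_distrib)
  have "branch_output ({..<2 * k} \<rightarrow>\<^sub>E X) ({..<2 * k} \<rightarrow>\<^sub>E Y) (copies (2 * k) \<sigma>) ((m, K), (m', L)) (i, j) (i', j') =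
    (\<Sum>s'\<in>?P. (\<Prod>t<k. flip_sign i' (s' t)) * ((\<Sum>r'\<in>?P. (\<Prod>t<k. flip_sign j' (r' t)) *
      ((\<Sum>s\<in>?P. (\<Prod>t<k. flip_sign i (s t)) * ((\<Sum>r\<in>?P. (\<Prod>t<k. flip_sign j (r t)) *
        copies (2 * k) \<sigma> (codeword k x s, codeword k y r) (codeword k x s', codeword k y r')) / ?r)) / ?r)) / ?r)) / ?r"
    by (subst branch_output_eq_iterated_sums[where A = "parity_filter k x" and B = "parity_filter k y"])
      (simp_all only: assms(5,6) cnj_parity_filter sum_parity_filter[OF assms(1,3)] sum_parity_filter[OF assms(2,4)])
  also have "\<dots> = (\<Sum>s'\<in>?P. \<Sum>r'\<in>?P. \<Sum>s\<in>?P. \<Sum>r\<in>?P. \<Prod>t<k.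
       flip_sign i' (s' t) * flip_sign j' (r' t) * flip_sign i (s t) * flip_sign j (r t) *
       (\<sigma> (x (s t), y (r t)) (x (s' t), y (r' t)) * \<sigma> (x (\<not> s t), y (\<not> r t)) (x (\<not> s' t), y (\<not> r' t)))) / 4 ^ k"
    unfolding copies_codeword
    by (simp add: prod.distrib sum_distrib_left mult.assoc flip: r4 sum_divide_distrib)
  also have "\<dots> = (\<Sum>a'\<in>UNIV. \<Sum>b'\<in>UNIV. \<Sum>a\<in>UNIV. \<Sum>b\<in>UNIV.
       flip_sign i' a' * flip_sign j' b' * flip_sign i a * flip_sign j b *
       (\<sigma> (x a, y b) (x a', y b') * \<sigma> (x (\<not> a), y (\<not> b)) (x (\<not> a'), y (\<not> b')))) ^ k / 4 ^ k"
    by (subst sum_PiE_prod4[where F = "\<lambda>a' b' a b. flip_sign i' a' * flip_sign j' b' * flip_sign i a * flip_sign j b *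
       (\<sigma> (x a, y b) (x a', y b') * \<sigma> (x (\<not> a), y (\<not> b)) (x (\<not> a'), y (\<not> b')))"]) simp_all
  finally show ?thesis by (simp add: power_divide)
qed

section \<open>Distillation from a correlated block\<close>

lemma one_over_one_plus_power_near_one:
  fixes r \<epsilon> :: real
  assumes "\<bar>r\<bar> < 1" "\<epsilon> > 0"
  obtains k :: nat where "k > 0" "1 + r ^ k > 0" "1 / (1 + r ^ k) \<ge> 1 - \<epsilon>"
proof -
  \<comment> \<open>The bound by 1 excludes \<open>k = 0\<close> and keeps \<open>1 + r ^ k\<close>
    positive, also for negative \<open>r\<close>.\<close>
  obtain k where k: "\<bar>r\<bar> ^ k < min \<epsilon> 1"
    using real_arch_pow_inv[of "min \<epsilon> 1" "\<bar>r\<bar>"] assms by auto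
  then have "k > 0" by (cases k) auto
  have b: "\<bar>r ^ k\<bar> < \<epsilon>" "\<bar>r ^ k\<bar> < 1" using k by (simp_all add: power_abs)
  have "(1 - r ^ k) * (1 + r ^ k) \<le> 1" by (simp add: algebra_simps)
  then have "1 - r ^ k \<le> 1 / (1 + r ^ k)" using b by (simp add: pos_le_divide_eq)
  then show ?thesis using that[OF \<open>k > 0\<close>] b by linarith
qed

text \<open>This isolates the quantum protocol: only the entries of the state among four product
  basis vectors matter.\<close>

lemma distillable_of_correlated_block:
  fixes \<sigma> :: "('a \<times> 'b, 'a \<times> 'b) cmat"
  assumes "finite X" "finite Y" "range x \<subseteq> X" "range y \<subseteq> Y"
    and "x True \<noteq> x False" "y True \<noteq> y False"
    and corr: "\<And>a b a' b'. a \<noteq> b \<or> a' \<noteq> b' \<Longrightarrow> \<sigma> (x a, y b) (x a', y b') = 0"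
    and diag: "\<And>a. \<sigma> (x a, y a) (x a, y a) = complex_of_real (p a)" "p True * p False > 0"
    and off: "\<And>a. \<sigma> (x (\<not> a), y (\<not> a)) (x a, y a) = cnj (\<sigma> (x a, y a) (x (\<not> a), y (\<not> a)))"
      "\<sigma> (x True, y True) (x False, y False) \<noteq> 0"
  shows "distillable X Y \<sigma>"
  unfolding distillable_def
proof (intro allI impI)
  fix \<epsilon> :: real assume "\<epsilon> > 0"
  define c where "c = \<sigma> (x True, y True) (x False, y False)"
  define A where "A = p True * p False"
  define B where "B = (cmod c)\<^sup>2"
  have AB: "A > 0" "B > 0" using diag(2) off(2) by (simp_all add: A_def B_def c_def)
  \<comment> \<open>On one pair the compressed state is \<open>A + B\<close> times the projector
    onto (|00> + |11>)/sqrt 2 plus \<open>A - B\<close> times the one onto (|00> - |11>)/sqrt 2;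
    \<open>r\<close> is the ratio of these weights.\<close>
  define r where "r = (A - B) / (A + B)"
  have r: "\<bar>r\<bar> < 1" using AB by (simp add: r_def abs_if divide_simps)
  have ArB: "A - B = (A + B) * r" using AB by (simp add: r_def)
  obtain k :: nat where k: "k > 0" "1 + r ^ k > 0" "1 / (1 + r ^ k) \<ge> 1 - \<epsilon>"
    using one_over_one_plus_power_near_one[OF r \<open>\<epsilon> > 0\<close>] .
  let ?X = "{..<2 * k} \<rightarrow>\<^sub>E X" and ?Y = "{..<2 * k} \<rightarrow>\<^sub>E Y"
  have "finite ?X" "finite ?Y" using assms(1,2) by (auto intro: finite_PiE)
  note orthX = parity_filter_orthonormal[OF assms(1,3,5) k(1)]
  note orthY = parity_filter_orthonormal[OF assms(2,4,6) k(1)]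
  obtain K L bs where l: "locc ?X ?Y (((2, K), (2, L)) # bs)"
    and K: "\<And>i w. w \<in> ?X \<Longrightarrow> K i w = parity_filter k x i w"
    and L: "\<And>j v. v \<in> ?Y \<Longrightarrow> L j v = parity_filter k y j v"
    by (rule locc_local_filters[OF \<open>finite ?X\<close> \<open>finite ?Y\<close>,
          where d = 2 and d' = 2 and K = "parity_filter k x" and L = "parity_filter k y"])
      (simp_all only: orthX orthY)
  define \<omega> where "\<omega> = branch_output ?X ?Y (copies (2 * k) \<sigma>) ((2, K), (2, L))"
  \<comment> \<open>The second copy sees the negated bits. Hence both diagonal entries become the
    same product, and a coherence meets its conjugate, which cancels its phase.\<close>
  have pair: "\<sigma> (x a, y b) (x a', y b') * \<sigma> (x (\<not> a), y (\<not> b)) (x (\<not> a'), y (\<not> b')) =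
      (if a = b \<and> a' = b' then if a = a' then complex_of_real A else complex_of_real B else 0)" for a b a' b'
    using corr[of a b a' b'] diag(1)[of True] diag(1)[of False] off(1)[of False] off(1)[of True]
      complex_norm_square[of c]
    by (cases a; cases a'; cases "b = a"; cases "b' = a'") (auto simp: A_def B_def c_def mult.commute)
  have \<omega>: "\<omega> (i, j) (i', j') = ((\<Sum>a'\<in>UNIV. \<Sum>b'\<in>UNIV. \<Sum>a\<in>UNIV. \<Sum>b\<in>UNIV.
       flip_sign i' a' * flip_sign j' b' * flip_sign i a * flip_sign j b *
       (if a = b \<and> a' = b' then if a = a' then complex_of_real A else complex_of_real B else 0)) / 4) ^ k" for i j i' j'
    unfolding \<omega>_def pair[symmetric] by (rule filtered_copies[OF assms(1-4)]) (simp_all add: K L)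
  define D where "D = ((A + B) / 2) ^ k"
  have D: "D > 0" using AB by (simp add: D_def)
  have D': "((A - B) / 2) ^ k = D * r ^ k" unfolding ArB D_def by (simp flip: power_mult_distrib)
  \<comment> \<open>In the Hadamard basis (|00> + |11>)/sqrt 2 lives on equal labels and (|00> -
    |11>)/sqrt 2 on opposite ones, so the two weights separate into \<open>\<omega>1\<close> and
    \<open>\<omega>2\<close>.\<close>
  have \<omega>1: "\<omega> (i, i) (j, j) = D" if "i < 2" "j < 2" for i j
    using that unfolding \<omega> D_def of_real_power
    by (intro arg_cong[where f = "\<lambda>z. z ^ k"]) (auto simp: UNIV_bool flip_sign_def less_2_cases_iff field_simps)
  have \<omega>2: "\<omega> (i, 1 - i) (i, 1 - i) = complex_of_real (D * r ^ k)" if "i < 2" for i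
    using that unfolding \<omega> D'[symmetric] of_real_power
    by (intro arg_cong[where f = "\<lambda>z. z ^ k"]) (auto simp: UNIV_bool flip_sign_def less_2_cases_iff field_simps)
  define q where "q = 2 * D * (1 + r ^ k)"
  have q: "q > 0" using D k(2) by (simp add: q_def)
  have tr: "mtrace two_qubits \<omega> = q"
    using \<omega>1[of 0 0] \<omega>1[of 1 1] \<omega>2[of 0] \<omega>2[of 1]
    by (simp add: mtrace_def two_qubits_def sum.cartesian_product' q_def algebra_simps)
  have s2: "complex_of_real (sqrt 2) * complex_of_real (sqrt 2) = 2" by (simp flip: of_real_mult)
  have "fidelity_max_entangled (\<lambda>u v. \<omega> u v / complex_of_real q) = 2 * D / q"
    using \<omega>1[of 0 0] \<omega>1[of 0 1] \<omega>1[of 1 0] \<omega>1[of 1 1]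
    by (simp add: fidelity_max_entangled_def two_qubits_def max_entangled_def s2 flip: of_real_divide)
  also have "\<dots> = 1 / (1 + r ^ k)" using D by (simp add: q_def)
  finally have fid: "fidelity_max_entangled (\<lambda>u v. \<omega> u v / complex_of_real q) \<ge> 1 - \<epsilon>" using k(3) by simp
  \<comment> \<open>The \<open>k\<close> pairs use \<open>2 * k\<close> copies, and only the first
    branch, where both filters succeed, counts as success.\<close>
  show "\<exists>k bs good. locc ({..<k} \<rightarrow>\<^sub>E X) ({..<k} \<rightarrow>\<^sub>E Y) bs \<and> good \<subseteq> {..<length bs} \<and>
        (\<forall>j\<in>good. fst (fst (bs ! j)) = 2 \<and> fst (snd (bs ! j)) = 2) \<and>
        (let \<omega> = (\<lambda>u v. \<Sum>j\<in>good. branch_output ({..<k} \<rightarrow>\<^sub>E X) ({..<k} \<rightarrow>\<^sub>E Y) (copies k \<sigma>) (bs ! j) u v);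
             p = Re (mtrace two_qubits \<omega>)
         in 0 < p \<and> fidelity_max_entangled (\<lambda>u v. \<omega> u v / complex_of_real p) \<ge> 1 - \<epsilon>)"
    using l q fid tr
    by (intro exI[of _ "2 * k"] exI[of _ "((2, K), (2, L)) # bs"] exI[of _ "{0}"])
       (simp add: \<omega>_def[symmetric])
qed

section \<open>Nonzero coherences and positivity\<close>

lemma mmult_assoc: "mmult Z (mmult Y A B) C x w = mmult Y A (mmult Z B C) x w"
  unfolding mmult_def sum_distrib_left sum_distrib_right mult.assoc
  by (rule sum.swap)

text \<open>Undoing the unitaries on both sides recovers \<open>\<rho>\<close>, so a vanishing block
  would make the trace of \<open>\<rho>\<close> zero.\<close>

lemma sandwich_nonzero:
  assumes "finite X" "mtrace X \<rho> \<noteq> 0" "unitary_operator X U" "unitary_operator X V"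
  obtains i j where "i \<in> X" "j \<in> X" "sandwich X U \<rho> V i j \<noteq> 0"
proof (rule ccontr)
  assume "\<not> thesis"
  then have zero: "sandwich X U \<rho> V i j = 0" if "i \<in> X" "j \<in> X" for i j
    using that \<open>\<And>j i. \<lbrakk>i \<in> X; j \<in> X; sandwich X U \<rho> V i j \<noteq> 0\<rbrakk> \<Longrightarrow> thesis\<close> by blast
  have left: "mmult X (mmult X (madj U) U) M i j = M i j" if "i \<in> X" for M :: "('a, 'a) cmat" and i j
    using assms(1,3) that
    by (simp add: mmult_def[of X "mmult X (madj U) U"] unitary_operator_def of_bool_def if_distrib[of "\<lambda>z. z * _"] cong: if_cong)
  have right: "mmult X M (mmult X (madj V) V) i j = M i j" if "j \<in> X" for M :: "('a, 'a) cmat" and i j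
    using assms(1,4) that
    by (simp add: mmult_def[of X M] unitary_operator_def of_bool_def if_distrib[of "\<lambda>z. _ * z"] cong: if_cong)
  have "\<rho> i i = 0" if "i \<in> X" for i
  proof -
    have "\<rho> i i = mmult X (mmult X (mmult X (madj U) U) \<rho>) (mmult X (madj V) V) i i"
      using that by (simp add: left right)
    also have "\<dots> = mmult X (madj U) (mmult X (sandwich X U \<rho> V) V) i i"
    proof -
      have "mmult X (mmult X (madj U) U) \<rho> = mmult X (madj U) (mmult X U \<rho>)"
        by (intro ext mmult_assoc)
      moreover have "mmult X P (mmult X (madj V) V) = mmult X (mmult X P (madj V)) V" for P :: "('a, 'a) cmat"
        by (intro ext mmult_assoc[symmetric])
      moreover have "mmult X (mmult X (madj U) (mmult X U \<rho>)) (madj V) = mmult X (madj U) (sandwich X U \<rho> V)"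
        unfolding sandwich_def by (intro ext mmult_assoc)
      ultimately show ?thesis by (simp add: mmult_assoc)
    qed
    also have "\<dots> = 0" by (simp add: mmult_def[of X "sandwich X U \<rho> V"] mmult_def[of X "madj U"] zero)
    finally show ?thesis .
  qed
  then show False using assms(2) by (simp add: mtrace_def)
qed

text \<open>A positive 2 by 2 matrix with a zero on its diagonal has no coherence. The quadratic
  form is tested on vectors supported on \<open>x\<close> and \<open>y\<close>.\<close>

lemma density_operator_diagonal:
  assumes "density_operator X \<sigma>" "finite X" "x \<in> X" "y \<in> X" "x \<noteq> y" "\<sigma> x y \<noteq> 0"
  shows "Re (\<sigma> x x) * Re (\<sigma> y y) > 0"
proof -
  define p where "p = Re (\<sigma> x x)"
  define q where "q = Re (\<sigma> y y)"
  define c where "c = \<sigma> x y"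
  have yx: "\<sigma> y x = cnj c" using assms(1,3,4) unfolding density_operator_def c_def by blast
  have form: "0 \<le> Re (cnj a * \<sigma> x x * a + cnj a * c * b + cnj b * cnj c * a + cnj b * \<sigma> y y * b)" for a b
  proof -
    define v where "v = (\<lambda>z. if z = x then a else if z = y then b else 0)"
    have red: "(\<Sum>z\<in>X. F z) = F x + F y" if "\<And>z. z \<noteq> x \<Longrightarrow> z \<noteq> y \<Longrightarrow> F z = 0" for F :: "'a \<Rightarrow> complex"
    proof -
      have "(\<Sum>z\<in>X. F z) = (\<Sum>z\<in>{x, y}. F z)"
        using assms(2-4) that by (intro sum.mono_neutral_right) auto
      then show ?thesis using assms(5) by simp
    qed
    have "(\<Sum>z\<in>X. \<Sum>w\<in>X. cnj (v z) * \<sigma> z w * v w) =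
      cnj a * \<sigma> x x * a + cnj a * c * b + cnj b * cnj c * a + cnj b * \<sigma> y y * b"
      using assms(5) by (subst red, simp add: v_def, subst (1 2) red) (auto simp: v_def yx c_def)
    moreover have "0 \<le> Re (\<Sum>z\<in>X. \<Sum>w\<in>X. cnj (v z) * \<sigma> z w * v w)"
      using assms(1) unfolding density_operator_def by blast
    ultimately show ?thesis by simp
  qed
  define n where "n = (cmod c)\<^sup>2"
  have n: "n > 0" using assms(6) by (simp add: n_def c_def)
  have nc: "Re c * Re c + Im c * Im c = n" unfolding n_def cmod_power2 by (simp add: power2_eq_square)
  have main: "0 \<le> s\<^sup>2 * n * p - 2 * s * n + q" for s
    using form[of "- of_real s * c" 1]
    by (simp add: p_def q_def nc[symmetric] power2_eq_square algebra_simps)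
  have main': "0 \<le> p - 2 * s * n + s\<^sup>2 * n * q" for s
    using form[of 1 "- of_real s * cnj c"]
    by (simp add: p_def q_def nc[symmetric] power2_eq_square algebra_simps)
  have p0: "p \<ge> 0" "q \<ge> 0" using main'[of 0] main[of 0] by simp_all
  \<comment> \<open>If \<open>p\<close> were 0, \<open>main\<close> would be linear in
    \<open>s\<close>, and this value of \<open>s\<close> would turn its right side into -1. The same
    choice with \<open>p\<close> and \<open>q\<close> exchanged serves \<open>main'\<close>.\<close>
  have "p \<noteq> 0" using main[of "(q + 1) / (2 * n)"] n p0 by auto
  moreover have "q \<noteq> 0" using main'[of "(p + 1) / (2 * n)"] n p0 by auto
  ultimately show ?thesis using p0 unfolding p_def q_def by (simp add: less_le)
qed

section \<open>Application to secret-sharing states\<close>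

lemma finite_bit_strings: "finite (bit_strings n)" and finite_even_strings: "finite (even_strings n)"
  and finite_shield_basis: "finite (shield_basis n d)"
  by (auto simp: bit_strings_def even_strings_def shield_basis_def intro!: finite_PiE)

lemma finite_group_basis: "finite S \<Longrightarrow> finite (group_basis S d)"
  by (auto simp: group_basis_def intro!: finite_PiE)

text \<open>The indicators in \<open>ketbra\<close> select at most one pair of strings, the key
  parts of the two labels.\<close>

lemma secret_sharing_entry:
  "(\<Sum>I\<in>even_strings n. \<Sum>J\<in>even_strings n.
     mtensor (ketbra I J) (T I J) (key_part n x, shield_part n x) (key_part n y, shield_part n y)) =
   (if key_part n x \<in> even_strings n \<and> key_part n y \<in> even_strings n
    then T (key_part n x) (key_part n y) (shield_part n x) (shield_part n y) else 0)"
proof -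
  have "(\<Sum>I\<in>even_strings n. \<Sum>J\<in>even_strings n.
      mtensor (ketbra I J) (T I J) (key_part n x, shield_part n x) (key_part n y, shield_part n y)) =
    (\<Sum>I\<in>even_strings n. if key_part n x = I then (\<Sum>J\<in>even_strings n. if key_part n y = J then T I J (shield_part n x) (shield_part n y) else 0) else 0)"
    by (intro sum.cong refl) (auto simp: mtensor_def ketbra_def intro!: sum.cong)
  then show ?thesis by (simp add: finite_even_strings)
qed

theorem theorem5:
  fixes n :: nat and d :: "nat \<Rightarrow> nat"
    and \<rho>\<^sub>n :: "(nat \<Rightarrow> nat \<times> nat, nat \<Rightarrow> nat \<times> nat) cmat"
    and S :: "nat set"
  assumes "n \<ge> 3"
    and "\<And>m. m \<in> {1..n} \<Longrightarrow> d m \<ge> 1"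
    and "secret_sharing_state n d \<rho>\<^sub>n"
    and "S \<subseteq> {1..n}" and "S \<noteq> {}" and "{1..n} - S \<noteq> {}"
  shows "distillable (group_basis S d) (group_basis ({1..n} - S) d) (bipartition n S \<rho>\<^sub>n)"
proof -
  let ?N = "{1..n}" and ?T = "{1..n} - S" and ?G = "group_basis {1..n} d" and ?D = "shield_basis n d"
  obtain \<rho> U where dens: "density_operator ?G \<rho>\<^sub>n" and \<rho>: "density_operator ?D \<rho>"
    and U: "\<And>I. I \<in> even_strings n \<Longrightarrow> unitary_operator ?D (U I)"
    and entry: "\<And>x y. x \<in> ?G \<Longrightarrow> y \<in> ?G \<Longrightarrow> \<rho>\<^sub>n x y = 1 / 2 ^ (n - 1) *
      (if key_part n x \<in> even_strings n \<and> key_part n y \<in> even_strings n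
       then sandwich ?D (U (key_part n x)) \<rho> (U (key_part n y)) (shield_part n x) (shield_part n y) else 0)"
    using assms(3) unfolding secret_sharing_state_def secret_sharing_entry by blast
  obtain s t where s: "s \<in> S" and t: "t \<in> ?T" using assms(5,6) by blast
  have st: "s \<in> ?N" "t \<in> ?N" "s \<noteq> t" using s t assms(4) by auto
  \<comment> \<open>One party on each side of the split carries a free bit and all others carry 0,
    so the total parity is even exactly when the two bits agree.\<close>
  define key where "key = (\<lambda>a b. \<lambda>m\<in>?N. if m = s then of_bool a else if m = t then of_bool b else 0 :: nat)"
  have key_even: "key a b \<in> even_strings n \<longleftrightarrow> a = b" for a b
  proof -
    have "{m \<in> ?N. key a b m = 1} = (if a then {s} else {}) \<union> (if b then {t} else {})"
      using st by (auto simp: key_def)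
    moreover have "key a b \<in> bit_strings n" by (auto simp: key_def bit_strings_def)
    ultimately show ?thesis using st by (auto simp: even_strings_def)
  qed
  have "mtrace ?D \<rho> \<noteq> 0" using \<rho> by (simp add: density_operator_def)
  then obtain i j where ij: "i \<in> ?D" "j \<in> ?D"
    and nz: "sandwich ?D (U (key True True)) \<rho> (U (key False False)) i j \<noteq> 0"
    using sandwich_nonzero[OF finite_shield_basis _ U U] key_even by metis
  \<comment> \<open>The shield label is tied to the key bit: the row label \<open>i\<close> goes
    with \<open>True\<close>, the column label \<open>j\<close> with \<open>False\<close>.\<close>
  define sh where "sh = (\<lambda>a. if a then i else j)"
  have sh: "sh a \<in> ?D" for a using ij by (simp add: sh_def)
  define x where "x = (\<lambda>a. \<lambda>m\<in>S. (key a a m, sh a m))"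
  define y where "y = (\<lambda>a. \<lambda>m\<in>?T. (key a a m, sh a m))"
  define z where "z = (\<lambda>a b. merge S ?T (x a, y b))"
  have sub: "S \<subseteq> ?N" by (fact assms(4))
  have shl: "m \<in> ?N \<Longrightarrow> sh a m < d m" for a m
    using sh[of a] by (auto simp: shield_basis_def PiE_iff)
  have key01: "key a b m \<in> {0, 1}" if "m \<in> ?N" for a b m using that by (simp add: key_def)
  have zin: "z a b \<in> ?G" for a b
    using sub shl key01 unfolding z_def x_def y_def group_basis_def
    by (auto simp: merge_def PiE_iff extensional_def)
  \<comment> \<open>Group \<open>S\<close> sees only the bit of \<open>s\<close> and the other group
    only that of \<open>t\<close>, so merging \<open>x a\<close> with \<open>y b\<close> produces
    both bits independently.\<close>
  have zkey: "key_part n (z a b) = key a b" for a b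
    using s t sub by (auto simp: fun_eq_iff key_part_def z_def merge_def x_def y_def key_def)
  \<comment> \<open>Only equal bits are considered: a mixed merge glues two shield labels, but its
    key is odd and its entries vanish.\<close>
  have zsh: "shield_part n (z a a) = sh a" for a
    using sub sh[of a] by (auto simp: fun_eq_iff shield_part_def z_def merge_def x_def y_def shield_basis_def PiE_iff extensional_def)
  have bip: "bipartition n S \<rho>\<^sub>n (x a, y b) (x a', y b') = \<rho>\<^sub>n (z a b) (z a' b')" for a b a' b'
    by (simp add: bipartition_def z_def)
  have off: "\<rho>\<^sub>n (z True True) (z False False) \<noteq> 0"
    using nz by (simp add: entry[OF zin zin] zkey zsh key_even sh_def)
  have zne: "z True True \<noteq> z False False"
  proof
    assume "z True True = z False False"
    then have "key True True s = key False False s" by (simp flip: zkey)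
    then show False using st(1) by (simp add: key_def)
  qed
  have herm: "\<rho>\<^sub>n u v = cnj (\<rho>\<^sub>n v u)" if "u \<in> ?G" "v \<in> ?G" for u v
    using dens that unfolding density_operator_def by blast
  show ?thesis
  proof (rule distillable_of_correlated_block[where x = x and y = y and p = "\<lambda>a. Re (\<rho>\<^sub>n (z a a) (z a a))"])
    show "finite (group_basis S d)" "finite (group_basis ?T d)"
      using finite_subset[OF sub] by (auto intro: finite_group_basis)
    show "range x \<subseteq> group_basis S d" "range y \<subseteq> group_basis ?T d"
      using sub shl key01 by (auto simp: x_def y_def group_basis_def split: if_splits)
    show "x True \<noteq> x False" using s st by (auto simp: x_def key_def fun_eq_iff)
    show "y True \<noteq> y False" using t st by (auto simp: y_def key_def fun_eq_iff)
    show "bipartition n S \<rho>\<^sub>n (x a, y b) (x a', y b') = 0" if "a \<noteq> b \<or> a' \<noteq> b'" for a b a' b'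
      using that by (auto simp: bip entry[OF zin zin] zkey key_even)
    show "bipartition n S \<rho>\<^sub>n (x a, y a) (x a, y a) = complex_of_real (Re (\<rho>\<^sub>n (z a a) (z a a)))" for a
      using herm[OF zin zin, of a a a a] by (simp add: bip complex_eq_iff)
    show "Re (\<rho>\<^sub>n (z True True) (z True True)) * Re (\<rho>\<^sub>n (z False False) (z False False)) > 0"
      by (rule density_operator_diagonal[where X = ?G])
        (fact dens zin zne off finite_group_basis[OF finite_atLeastAtMost])+
    show "bipartition n S \<rho>\<^sub>n (x (\<not> a), y (\<not> a)) (x a, y a) =
        cnj (bipartition n S \<rho>\<^sub>n (x a, y a) (x (\<not> a), y (\<not> a)))" for a
      unfolding bip by (rule herm[OF zin zin])
    show "bipartition n S \<rho>\<^sub>n (x True, y True) (x False, y False) \<noteq> 0"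
      using off by (simp add: bip)
  qed
qed

end
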